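(* For $n\ge 1$ let $s_n=|S_n(123,231)|$ be the number of permutations of $\{1,\dots,n\}$ that simultaneously avoid the contiguous patterns $123$ and $231$, and for $1\le i\le n$ let $s_n(i)$ be the number of those permutations $\pi=\pi_1\pi_2\cdots\pi_n$ with $\pi_1=i$. Then for all $n\geq 3$, $$s_n=s_{n-1}+s_n(1)+s_n(2)+\cdots+s_n(n-1),$$ where for all $1\leq i\leq n$, $$s_n(i)=\sum_{j=1}^{i-1} s_{n-1}(j)+\sum_{j=i}^{n-2}(n-1-j)\,s_{n-2}(j),$$ and $s_3(1)=1$, $s_3(2)=1$, $s_3(3)=2$.
   Context: Permutations of $\{1,\dots,n\}$ are written as words $\pi=\pi_1\pi_2\cdots\pi_n$. A pattern with no dashes, such as $123$ or $231$, is a contiguous pattern: $\pi$ contains it if some three consecutive letters $\pi_a\pi_{a+1}\pi_{a+2}$ are order-isomorphic to it, and $\pi$ avoids it otherwise. $S_n(123,231)$ is the set of permutations of $\{1,\dots,n\}$ avoiding both contiguous patterns. Empty sums are $0$. *)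

theory Defs
  imports Main "HOL-Library.Sublist" "HOL-Combinatorics.Multiset_Permutations"
begin

definition order_isomorphic :: "nat list \<Rightarrow> nat list \<Rightarrow> bool" where
  "order_isomorphic u v \<longleftrightarrow>
     length u = length v \<and>
     (\<forall>a < length u. \<forall>b < length u. u ! a < u ! b \<longleftrightarrow> v ! a < v ! b)"

(* Contiguous (dash-free) containment: sublist in HOL-Library.Sublist means a block of
   consecutive letters, as opposed to subseq. *)
definition contains_contiguous :: "nat list \<Rightarrow> nat list \<Rightarrow> bool" where
  "contains_contiguous \<pi> p \<longleftrightarrow> (\<exists>u. sublist u \<pi> \<and> order_isomorphic u p)"

definition contiguous_avoiders :: "nat \<Rightarrow> nat list set \<Rightarrow> nat list set" where
  "contiguous_avoiders n P =
     {\<pi> \<in> permutations_of_set {1..n}. \<forall>p \<in> P. \<not> contains_contiguous \<pi> p}"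

definition s :: "nat \<Rightarrow> nat" where
  "s n = card (contiguous_avoiders n {[1,2,3], [2,3,1]})"

(* Meaningful for n > 0 only: hd of the empty word is unspecified. *)
definition s_first :: "nat \<Rightarrow> nat \<Rightarrow> nat" where
  "s_first n i = card {\<pi> \<in> contiguous_avoiders n {[1,2,3], [2,3,1]}. hd \<pi> = i}"

end

theory Submission
  imports Defs
begin

text \<open>
  The idea is to delete letters from the front of an avoiding word. If \<open>\<pi>\<^sub>1 > \<pi>\<^sub>2\<close>, the triple
  \<open>\<pi>\<^sub>1\<pi>\<^sub>2\<pi>\<^sub>3\<close> can be neither a 123 nor a 231, because both patterns begin with an ascent; hence
  \<open>\<pi>\<^sub>1\<close> may be deleted, and the rest is an arbitrary avoiding word that starts below \<open>\<pi>\<^sub>1\<close>. If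
  \<open>\<pi>\<^sub>1 < \<pi>\<^sub>2\<close>, avoiding the two patterns forces \<open>\<pi>\<^sub>1 < \<pi>\<^sub>3 < \<pi>\<^sub>2\<close>; then \<open>\<pi>\<^sub>2 > \<pi>\<^sub>3\<close> is a descent, so
  the first two letters may be deleted, and the rest is an arbitrary avoiding word that starts
  between \<open>\<pi>\<^sub>1\<close> and \<open>\<pi>\<^sub>2\<close>.

  The deletion is first carried out for words over an arbitrary finite set of letters
  (\<open>avoiders_from_decomp\<close>), where nothing has to be relabelled. Counting then uses that
  avoidance depends only on the relative order of the letters (\<open>card_avoiders_from_image\<close>): the
  letters \<open>{1..n} - {i}\<close> and \<open>{1..n} - {i, k}\<close> are replaced by \<open>{1..n-1}\<close> and \<open>{1..n-2}\<close>. In the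
  second case the first letter \<open>m\<close> of the rest satisfies \<open>i < m < k\<close> and becomes \<open>j = m - 1\<close>; the
  \<open>n - m = n - 1 - j\<close> choices of \<open>k\<close> give the coefficient in the second sum. For \<open>i = n\<close> the
  second sum is empty and the first is \<open>s\<^bsub>n-1\<^esub>\<close>, which gives the formula for \<open>s\<^sub>n\<close>.
\<close>

section \<open>Avoidance and relative order\<close>

lemma order_isomorphic_map:
  assumes "strict_mono_on (set u) f"
  shows "order_isomorphic (map f u) p \<longleftrightarrow> order_isomorphic u p"
proof -
  have "f (u ! a) < f (u ! b) \<longleftrightarrow> u ! a < u ! b" if "a < length u" "b < length u" for a b
    using that strict_mono_on_less[OF assms] by simp
  then show ?thesis by (simp add: order_isomorphic_def)
qed

lemma contains_contiguous_map:
  assumes "strict_mono_on (set w) f"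
  shows "contains_contiguous (map f w) p \<longleftrightarrow> contains_contiguous w p"
proof -
  have iso: "order_isomorphic (map f u) p \<longleftrightarrow> order_isomorphic u p" if "sublist u w" for u
    by (intro order_isomorphic_map monotone_on_subset[OF assms] set_mono_sublist that)
  have "sublist v (map f w) \<longleftrightarrow> (\<exists>u. sublist u w \<and> v = map f u)" for v
    by (metis map_mono_sublist sublist_map_rightE)
  then show ?thesis
    unfolding contains_contiguous_def using iso by metis
qed

lemma order_isomorphic_123: "order_isomorphic u [1,2,3] \<longleftrightarrow> (\<exists>x y z. u = [x,y,z] \<and> x < y \<and> y < z)"
proof -
  have "order_isomorphic [x,y,z] [1,2,3] \<longleftrightarrow> x < y \<and> y < z" for x y z
    by (simp add: order_isomorphic_def All_less_Suc2) linarith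
  moreover have "\<exists>x y z. u = [x,y,z]" if "order_isomorphic u [1,2,3]"
  proof -
    have "length u = Suc (Suc (Suc 0))" using that by (simp add: order_isomorphic_def)
    then show ?thesis by (auto simp: length_Suc_conv)
  qed
  ultimately show ?thesis by blast
qed

lemma order_isomorphic_231: "order_isomorphic u [2,3,1] \<longleftrightarrow> (\<exists>x y z. u = [x,y,z] \<and> z < x \<and> x < y)"
proof -
  have "order_isomorphic [x,y,z] [2,3,1] \<longleftrightarrow> z < x \<and> x < y" for x y z
    by (simp add: order_isomorphic_def All_less_Suc2) linarith
  moreover have "\<exists>x y z. u = [x,y,z]" if "order_isomorphic u [2,3,1]"
  proof -
    have "length u = Suc (Suc (Suc 0))" using that by (simp add: order_isomorphic_def)
    then show ?thesis by (auto simp: length_Suc_conv)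
  qed
  ultimately show ?thesis by blast
qed

definition avoiding :: "nat list \<Rightarrow> bool" where
  "avoiding w \<longleftrightarrow> (\<forall>p \<in> {[1,2,3], [2,3,1]}. \<not> contains_contiguous w p)"

lemma avoiding_iff:
  "avoiding w \<longleftrightarrow> (\<forall>x y z. sublist [x,y,z] w \<longrightarrow> \<not> (x < y \<and> y < z) \<and> \<not> (z < x \<and> x < y))"
proof -
  have "contains_contiguous w [1,2,3] \<longleftrightarrow> (\<exists>x y z. sublist [x,y,z] w \<and> x < y \<and> y < z)"
    unfolding contains_contiguous_def order_isomorphic_123 by metis
  moreover have "contains_contiguous w [2,3,1] \<longleftrightarrow> (\<exists>x y z. sublist [x,y,z] w \<and> z < x \<and> x < y)"
    unfolding contains_contiguous_def order_isomorphic_231 by metis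
  ultimately show ?thesis unfolding avoiding_def ball_simps by metis
qed

lemma avoiding_Cons:
  "avoiding (x # w) \<longleftrightarrow>
     (\<forall>y z. prefix [y,z] w \<longrightarrow> \<not> (x < y \<and> y < z) \<and> \<not> (z < x \<and> x < y)) \<and> avoiding w"
proof -
  have sublist: "sublist [a,b,c] (x # w) \<longleftrightarrow> a = x \<and> prefix [b,c] w \<or> sublist [a,b,c] w" for a b c
    by (simp add: sublist_Cons_right)
  show ?thesis unfolding avoiding_iff sublist by blast
qed

text \<open>Both patterns begin with an ascent, so no occurrence can start with the descent \<open>x > y\<close>.\<close>

lemma avoiding_Cons_descent:
  assumes "y < x"
  shows "avoiding (x # y # w) \<longleftrightarrow> avoiding (y # w)"
  unfolding avoiding_Cons[of x] using assms by simp

text \<open>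
  After the ascent \<open>x < y\<close>, the letter \<open>z\<close> may not exceed \<open>y\<close> (pattern 123) nor lie below \<open>x\<close>
  (pattern 231). So \<open>y > z\<close> is a descent, and \<open>y\<close> can be dropped together with \<open>x\<close>.
\<close>

lemma avoiding_Cons_ascent:
  assumes "x < y" "distinct (x # y # z # w)"
  shows "avoiding (x # y # z # w) \<longleftrightarrow> x < z \<and> z < y \<and> avoiding (z # w)"
proof -
  have "avoiding (x # y # z # w) \<longleftrightarrow> x < z \<and> z < y \<and> avoiding (y # z # w)"
    unfolding avoiding_Cons[of x] using assms by auto
  then show ?thesis using avoiding_Cons_descent by blast
qed

section \<open>Avoiding words over a set of letters\<close>

definition avoiders_from :: "nat set \<Rightarrow> nat \<Rightarrow> nat list set" where
  "avoiders_from A x = {w \<in> permutations_of_set A. avoiding w \<and> hd w = x}"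

lemma finite_avoiders_from [simp]: "finite (avoiders_from A x)"
  by (simp add: avoiders_from_def)

lemma avoiders_from_ConsE:
  assumes "w \<in> avoiders_from A x" "a \<in> A"
  obtains r where "w = x # r"
proof -
  have "set w = A" "hd w = x"
    using assms(1) by (auto simp: avoiders_from_def permutations_of_set_def)
  then show ?thesis using assms(2) that[of "tl w"] by (cases w) auto
qed

lemma s_first_eq: "s_first n i = card (avoiders_from {1..n} i)"
  unfolding s_first_def avoiders_from_def contiguous_avoiders_def avoiding_def
  by (rule arg_cong[of _ _ card]) blast

text \<open>
  The number of avoiding words depends only on the size of the alphabet and on the rank of the
  first letter in it.
\<close>

lemma card_avoiders_from_image:
  assumes f: "strict_mono_on A f" and x: "x \<in> A"
  shows "card (avoiders_from (f ` A) (f x)) = card (avoiders_from A x)"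
proof -
  have inj: "inj_on f A" using f by (rule strict_mono_on_imp_inj_on)
  have "avoiding (map f w) \<and> hd (map f w) = f x \<longleftrightarrow> avoiding w \<and> hd w = x"
    if "w \<in> permutations_of_set A" for w
  proof -
    have w: "set w = A" using that by (simp add: permutations_of_set_def)
    then have "w \<noteq> []" using x by auto
    then show ?thesis
      using f x w inj by (auto simp: avoiding_def contains_contiguous_map hd_map inj_on_eq_iff)
  qed
  then have "avoiders_from (f ` A) (f x) = map f ` avoiders_from A x"
    unfolding avoiders_from_def permutations_of_set_image_inj[OF inj] by auto
  moreover have "inj_on (map f) (avoiders_from A x)"
    using inj by (intro inj_on_mapI) (auto intro: inj_on_subset
        simp: avoiders_from_def permutations_of_set_def)
  ultimately show ?thesis by (simp add: card_image)
qed

text \<open>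
  The first union collects the words that start with a descent, the second those that start with
  an ascent; \<open>j\<close>, \<open>k\<close> and \<open>m\<close> are the letters that follow \<open>i\<close>. In the second case \<open>i < m < k\<close>
  is forced by avoidance. Three letters are needed because the right-hand side would miss the
  word \<open>[i, k]\<close> with \<open>i < k\<close>.
\<close>

lemma avoiders_from_decomp:
  assumes "i \<in> A" "card A \<ge> 3"
  shows "avoiders_from A i =
           (\<Union>j\<in>{j\<in>A. j < i}. (#) i ` avoiders_from (A - {i}) j) \<union>
           (\<Union>(m, k)\<in>{(m, k). m \<in> A \<and> k \<in> A \<and> i < m \<and> m < k}.
              (\<lambda>w. i # k # w) ` avoiders_from (A - {i, k}) m)"
    (is "_ = ?D \<union> ?U")
proof (intro equalityI subsetI)
  fix v assume "v \<in> avoiders_from A i"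
  then have v: "set v = A" "distinct v" "avoiding v" "hd v = i"
    by (auto simp: avoiders_from_def permutations_of_set_def)
  have "length v \<ge> 3" using v assms distinct_card[of v] by simp
  then obtain k m w where eq: "v = i # k # m # w"
    using v by (auto simp: numeral_3_eq_3 Suc_le_length_iff)
  show "v \<in> ?D \<union> ?U"
  proof (cases "k < i")
    case True
    then have "k # m # w \<in> avoiders_from (A - {i}) k" "k \<in> A"
      using v eq by (auto simp: avoiders_from_def permutations_of_set_def avoiding_Cons_descent)
    then show ?thesis using True eq by blast
  next
    case False
    then have "i < k" using v eq by auto
    then have "i < m" "m < k" "avoiding (m # w)"
      using v eq avoiding_Cons_ascent by auto
    then have "m # w \<in> avoiders_from (A - {i, k}) m" "k \<in> A" "m \<in> A"
      using v eq by (auto simp: avoiders_from_def permutations_of_set_def)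
    then have "v \<in> ?U"
      using \<open>i < m\<close> \<open>m < k\<close> eq by (intro UN_I[of "(m, k)"]) simp_all
    then show ?thesis ..
  qed
next
  fix v assume "v \<in> ?D \<union> ?U"
  then consider (down) j w where "j \<in> A" "j < i" "v = i # w" "w \<in> avoiders_from (A - {i}) j"
    | (up) m k w where "m \<in> A" "k \<in> A" "i < m" "m < k" "v = i # k # w"
        "w \<in> avoiders_from (A - {i, k}) m"
  proof (elim UnE UN_E imageE, goal_cases)
    case (1 j w)
    then show ?thesis by (intro that(1)[of j w]) simp_all
  next
    case (2 q)
    obtain m k where q: "q = (m, k)" by (cases q)
    from 2(4) obtain w where "v = i # k # w" "w \<in> avoiders_from (A - {i, k}) m"
      unfolding q prod.case by (elim imageE)
    with 2(3) show ?thesis unfolding q by (intro that(2)[of m k w]) simp_all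
  qed
  then show "v \<in> avoiders_from A i"
  proof cases
    case down
    then obtain r where "w = j # r" using avoiders_from_ConsE[of w "A - {i}" j j] by auto
    with down show ?thesis using assms
      by (auto simp: avoiders_from_def permutations_of_set_def avoiding_Cons_descent)
  next
    case up
    then obtain r where r: "w = m # r" using avoiders_from_ConsE[of w "A - {i, k}" m m] by auto
    then have v: "set v = A" "distinct v" "avoiding (m # r)"
      using up assms by (auto simp: avoiders_from_def permutations_of_set_def)
    then have "avoiding v" using avoiding_Cons_ascent[of i k m r] up r by auto
    then show ?thesis using v up by (simp add: avoiders_from_def permutations_of_set_def)
  qed
qed

lemma card_avoiders_from_decomp:
  assumes "i \<in> A" "card A \<ge> 3"
  shows "card (avoiders_from A i) =
           (\<Sum>j\<in>{j\<in>A. j < i}. card (avoiders_from (A - {i}) j)) +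
           (\<Sum>(m, k)\<in>{(m, k). m \<in> A \<and> k \<in> A \<and> i < m \<and> m < k}.
              card (avoiders_from (A - {i, k}) m))"
proof -
  let ?J = "{j\<in>A. j < i}" and ?P = "{(m, k). m \<in> A \<and> k \<in> A \<and> i < m \<and> m < k}"
  let ?D = "\<lambda>j. (#) i ` avoiders_from (A - {i}) j"
  let ?U = "\<lambda>(m, k). (\<lambda>w. i # k # w) ` avoiders_from (A - {i, k}) m"
  have "finite A" using assms(2) by (intro card_ge_0_finite) simp
  moreover from this have "finite ?P"
    by (intro finite_subset[of ?P "A \<times> A"]) auto
  ultimately have fin: "finite ?J" "finite ?P" by simp_all
  \<comment> \<open>The second letter of a word tells which of the two unions contains it.\<close>
  have hd_down: "hd (tl v) < i" if "v \<in> \<Union> (?D ` ?J)" for v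
    using that by (auto simp: avoiders_from_def)
  have hd_up: "hd (tl v) > i" if "v \<in> \<Union> (?U ` ?P)" for v
    using that by auto
  have "\<Union> (?D ` ?J) \<inter> \<Union> (?U ` ?P) = {}"
    using hd_down hd_up by (meson disjoint_iff order.asym)
  then have "card (avoiders_from A i) = card (\<Union> (?D ` ?J)) + card (\<Union> (?U ` ?P))"
    unfolding avoiders_from_decomp[OF assms] using fin by (intro card_Un_disjoint) auto
  also have "card (\<Union> (?D ` ?J)) = (\<Sum>j\<in>?J. card (?D j))"
    using fin by (intro card_UN_disjoint) (auto simp: avoiders_from_def)
  also have "\<dots> = (\<Sum>j\<in>?J. card (avoiders_from (A - {i}) j))"
    by (simp add: card_image)
  also have "card (\<Union> (?U ` ?P)) = (\<Sum>q\<in>?P. card (?U q))"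
  proof (intro card_UN_disjoint fin ballI impI)
    \<comment> \<open>The pair \<open>(m, k)\<close> can be read off the word as its third and second letters.\<close>
    have index: "q = (hd (tl (tl v)), hd (tl v))" if "v \<in> ?U q" for v q
      using that by (cases q) (auto simp: avoiders_from_def)
    show "?U q \<inter> ?U q' = {}" if "q \<noteq> q'" for q q'
    proof (rule ccontr)
      assume "?U q \<inter> ?U q' \<noteq> {}"
      then obtain v where "v \<in> ?U q" "v \<in> ?U q'" by blast
      then show False using \<open>q \<noteq> q'\<close> by (auto dest!: index)
    qed
  qed (simp add: case_prod_beta)
  also have "\<dots> = (\<Sum>(m, k)\<in>?P. card (avoiders_from (A - {i, k}) m))"
    by (intro sum.cong refl) (simp add: case_prod_beta card_image inj_on_def)
  finally show ?thesis .
qed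

section \<open>Relabelling and the recurrences\<close>

text \<open>The increasing enumeration of the naturals other than \<open>i\<close>.\<close>

definition skip :: "nat \<Rightarrow> nat \<Rightarrow> nat" where
  "skip i j = (if j < i then j else Suc j)"

lemma strict_mono_skip: "strict_mono (skip i)"
  by (auto simp: strict_mono_def skip_def)

lemma image_skip:
  assumes "1 \<le> i" "i \<le> n"
  shows "skip i ` {1..n - 1} = {1..n} - {i}"
proof (intro equalityI subsetI)
  fix m assume m: "m \<in> {1..n} - {i}"
  show "m \<in> skip i ` {1..n - 1}"
  proof (cases "m < i")
    case True
    then show ?thesis using m assms by (intro image_eqI[of _ _ m]) (auto simp: skip_def)
  next
    case False
    then show ?thesis using m assms by (intro image_eqI[of _ _ "m - 1"]) (auto simp: skip_def)
  qed
qed (use assms in \<open>auto simp: skip_def\<close>)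

lemma card_avoiders_from_delete_one:
  assumes "1 \<le> j" "j < i" "i \<le> n"
  shows "card (avoiders_from ({1..n} - {i}) j) = s_first (n - 1) j"
proof -
  have "skip i j = j" using assms by (simp add: skip_def)
  moreover have "skip i ` {1..n - 1} = {1..n} - {i}"
    using assms by (intro image_skip) auto
  ultimately show ?thesis
    using card_avoiders_from_image[of "{1..n - 1}" "skip i" j] assms
      monotone_on_subset[OF strict_mono_skip] by (simp add: s_first_eq)
qed

lemma card_avoiders_from_delete_two:
  assumes "1 \<le> i" "i < m" "m < k" "k \<le> n"
  shows "card (avoiders_from ({1..n} - {i, k}) m) = s_first (n - 2) (m - 1)"
proof -
  \<comment> \<open>After the deletion of \<open>i\<close> from \<open>{1..n}\<close>, the letter \<open>k\<close> has become \<open>k - 1\<close>.\<close>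
  let ?f = "\<lambda>j. skip i (skip (k - 1) j)"
  have mono: "strict_mono_on {1..n - 2} ?f"
    using strict_mono_skip by (auto simp: monotone_on_def)
  have "?f ` {1..n - 2} = skip i ` ({1..n - 1} - {k - 1})"
    using image_skip[of "k - 1" "n - 1"] assms
    by (simp add: image_image[symmetric] numeral_2_eq_2)
  also have "\<dots> = ({1..n} - {i}) - {skip i (k - 1)}"
    using image_skip[of i n] assms
    by (simp add: image_set_diff strict_mono_imp_inj_on strict_mono_skip)
  also have "\<dots> = {1..n} - {i, k}" using assms by (auto simp: skip_def)
  finally have "?f ` {1..n - 2} = {1..n} - {i, k}" .
  moreover have "?f (m - 1) = m" using assms by (auto simp: skip_def)
  moreover have "m - 1 \<in> {1..n - 2}" using assms by auto
  ultimately show ?thesis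
    using card_avoiders_from_image[OF mono, of "m - 1"] by (simp add: s_first_eq)
qed

lemma s_first_recurrence:
  assumes n: "n \<ge> 3" and i: "1 \<le> i" "i \<le> n"
  shows "s_first n i = (\<Sum>j = 1..i - 1. s_first (n - 1) j)
                     + (\<Sum>j = i..n - 2. (n - 1 - j) * s_first (n - 2) j)"
proof -
  let ?P = "{(m, k). m \<in> {1..n} \<and> k \<in> {1..n} \<and> i < m \<and> m < k}"
  have "(\<Sum>j\<in>{j\<in>{1..n}. j < i}. card (avoiders_from ({1..n} - {i}) j))
        = (\<Sum>j = 1..i - 1. s_first (n - 1) j)"
    by (intro sum.cong card_avoiders_from_delete_one) (use i in auto)
  moreover have "(\<Sum>(m, k)\<in>?P. card (avoiders_from ({1..n} - {i, k}) m))
        = (\<Sum>j = i..n - 2. (n - 1 - j) * s_first (n - 2) j)"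
  proof -
    \<comment> \<open>The value \<open>m = n\<close> is left out because it admits no \<open>k\<close>. The bounds are written with
      \<open>Suc\<close> to prepare the shift to \<open>j = m - 1\<close>.\<close>
    have "(\<Sum>(m, k)\<in>?P. card (avoiders_from ({1..n} - {i, k}) m))
        = (\<Sum>(m, k)\<in>(SIGMA m:{Suc i..Suc (n - 2)}. {Suc m..n}). s_first (n - 2) (m - 1))"
      using i by (intro sum.cong) (auto simp: card_avoiders_from_delete_two simp del: One_nat_def)
    also have "\<dots> = (\<Sum>m = Suc i..Suc (n - 2). (n - m) * s_first (n - 2) (m - 1))"
      by (subst sum.Sigma[symmetric]) auto
    also have "\<dots> = (\<Sum>j = i..n - 2. (n - 1 - j) * s_first (n - 2) j)"
      by (subst sum.shift_bounds_cl_Suc_ivl) simp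
    finally show ?thesis .
  qed
  ultimately show ?thesis
    using card_avoiders_from_decomp[of i "{1..n}"] assms by (simp add: s_first_eq)
qed

lemma s_eq_sum_s_first:
  assumes "n \<ge> 1"
  shows "s n = (\<Sum>i = 1..n. s_first n i)"
proof -
  let ?S = "contiguous_avoiders n {[1,2,3], [2,3,1]}"
  have fin: "finite ?S" by (simp add: contiguous_avoiders_def)
  have "hd w \<in> {1..n}" if "w \<in> ?S" for w
  proof -
    have w: "set w = {1..n}"
      using that by (simp add: contiguous_avoiders_def permutations_of_set_def)
    then have "w \<noteq> []" using assms by auto
    then show ?thesis using w hd_in_set by blast
  qed
  then have "?S = (\<Union>i\<in>{1..n}. {w \<in> ?S. hd w = i})" by blast
  then have "card ?S = card (\<Union>i\<in>{1..n}. {w \<in> ?S. hd w = i})" by (rule arg_cong)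
  also have "\<dots> = (\<Sum>i = 1..n. card {w \<in> ?S. hd w = i})"
    using fin by (intro card_UN_disjoint) auto
  finally show ?thesis unfolding s_def s_first_def .
qed

text \<open>
  The recurrence at \<open>n = 3\<close> refers to lengths 1 and 2, where every word avoids both patterns
  because a forbidden factor has three letters.
\<close>

lemma s_first_small: "s_first 1 1 = 1" "s_first 2 1 = 1" "s_first 2 2 = 1"
proof -
  have short: "avoiding w" if "length w \<le> 2" for w
    using that by (auto simp: avoiding_iff dest!: sublist_length_le)
  have one: "avoiders_from {1..1} 1 = {[1]}"
    using short by (auto simp: avoiders_from_def)
  have "{1..2} = {1, 2::nat}" by auto
  then have perms: "permutations_of_set {1..2::nat} = {[1,2], [2,1]}"
    by (simp add: permutations_of_set_doubleton)
  have two: "avoiders_from {1..2} 1 = {[1,2]}" "avoiders_from {1..2} 2 = {[2,1]}"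
    unfolding avoiders_from_def perms using short by auto
  show "s_first 1 1 = 1" "s_first 2 1 = 1" "s_first 2 2 = 1"
    unfolding s_first_eq one two by simp_all
qed

theorem proposition1:
  "(\<forall>n::nat. n \<ge> 3 \<longrightarrow>
      s n = s (n - 1) + (\<Sum>i = 1..n - 1. s_first n i) \<and>
      (\<forall>i. 1 \<le> i \<and> i \<le> n \<longrightarrow>
         s_first n i = (\<Sum>j = 1..i - 1. s_first (n - 1) j)
                     + (\<Sum>j = i..n - 2. (n - 1 - j) * s_first (n - 2) j))) \<and>
   s_first 3 1 = 1 \<and> s_first 3 2 = 1 \<and> s_first 3 3 = 2"
proof (intro conjI allI impI)
  fix n :: nat assume n: "n \<ge> 3"
  have "s n = (\<Sum>i = 1..n - 1. s_first n i) + s_first n n"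
    using n by (cases n) (simp_all add: s_eq_sum_s_first)
  also have "s_first n n = (\<Sum>j = 1..n - 1. s_first (n - 1) j)"
    using s_first_recurrence[of n n] n by simp
  also have "\<dots> = s (n - 1)"
    using n by (simp add: s_eq_sum_s_first)
  finally show "s n = s (n - 1) + (\<Sum>i = 1..n - 1. s_first n i)" by simp
next
  fix n i :: nat assume "n \<ge> 3" "1 \<le> i \<and> i \<le> n"
  then show "s_first n i = (\<Sum>j = 1..i - 1. s_first (n - 1) j)
                     + (\<Sum>j = i..n - 2. (n - 1 - j) * s_first (n - 2) j)"
    using s_first_recurrence by blast
next
  show "s_first 3 1 = 1" "s_first 3 2 = 1" "s_first 3 3 = 2"
    using s_first_recurrence[of 3 1] s_first_recurrence[of 3 2] s_first_recurrence[of 3 3]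
      s_first_small by (simp_all add: numeral_2_eq_2)
qed

end
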